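(* Let $(V,\rho)$ be a finite rank torsion free $\mathfrak{sl}(2)$-module. If $(V,\rho)$ is a simple $\mathfrak{sl}(2)$-module, then its rationalization $F_{\mathrm{rat}}(V,\rho)$ is an $\mathcal R$-irreducible rational module. Conversely, if $F_{\mathrm{rat}}(V,\rho)$ is an $\mathcal R$-irreducible rational module, then either $(V,\rho)$ is a simple $\mathfrak{sl}(2)$-module or it has a unique simple $\mathfrak{sl}(2)$-submodule $(V',\rho')\subseteq(V,\rho)$ which is an essential submodule.
   Context: $\mathfrak{sl}(2)$ has basis $L_{-1}=f$, $L_0=-\tfrac12 h$, $L_1=-e$ for a Chevalley basis $e,f,h$. An $\mathfrak{sl}(2)$-module $(V,\rho)$ is a $\mathbb{C}[z]$-module via $z\cdot v=\rho(L_0)v$; it is finite rank torsion free if torsion free as a $\mathbb{C}[z]$-module and $S^{-1}V$ is finite-dimensional over $\mathbb{C}(z)$, $S=\mathbb{C}[z]\setminus\{0\}$. A submodule $V'\subseteq V$ is essential if $V/V'$ is a torsion $\mathbb{C}[z]$-module. The rationalization is $F_{\mathrm{rat}}(V,\rho)=(S^{-1}V,\rho_{\mathrm{rat}})$ with $\rho_{\mathrm{rat}}(L_{\pm1})(v/p(z))=\rho(L_{\pm1})(v)/p(z\pm1)$, $\rho_{\mathrm{rat}}(L_0)(v/p(z))=zv/p(z)$. A rational module (an $\mathfrak{sl}(2)$-module that is a finite-dimensional $\mathbb{C}(z)$-vector space with $z$ acting by $L_0$) is $\mathcal R$-irreducible if it is nonzero and has no nonzero proper $\mathfrak{sl}(2)$-submodule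 that is a $\mathbb{C}(z)$-subspace. *)

theory Defs
  imports "HOL-Computational_Algebra.Polynomial" "HOL-Computational_Algebra.Fraction_Field"
begin

text \<open>An sl(2)-module is a complex vector space (carrier = the whole type 'v, scalar
multiplication sc) with linear operators Lm = rho(L_{-1}), L0 = rho(L_0), Lp = rho(L_1)
satisfying [L_m, L_n] = (m - n) L_{m+n}.\<close>

definition sl2_module ::
  "(complex \<Rightarrow> 'v::ab_group_add \<Rightarrow> 'v) \<Rightarrow> ('v \<Rightarrow> 'v) \<Rightarrow> ('v \<Rightarrow> 'v) \<Rightarrow> ('v \<Rightarrow> 'v) \<Rightarrow> bool" where
  "sl2_module sc Lm L0 Lp \<longleftrightarrow>
     vector_space sc \<and>
     Vector_Spaces.linear sc sc Lm \<and> Vector_Spaces.linear sc sc L0 \<and> Vector_Spaces.linear sc sc Lp \<and>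
     (\<forall>v. L0 (Lm v) - Lm (L0 v) = Lm v) \<and>
     (\<forall>v. L0 (Lp v) - Lp (L0 v) = - Lp v) \<and>
     (\<forall>v. Lp (Lm v) - Lm (Lp v) = sc 2 (L0 v))"

definition pact :: "(complex \<Rightarrow> 'v::ab_group_add \<Rightarrow> 'v) \<Rightarrow> ('v \<Rightarrow> 'v) \<Rightarrow> complex poly \<Rightarrow> 'v \<Rightarrow> 'v" where
  "pact sc L0 p v = (\<Sum>i\<le>degree p. sc (coeff p i) ((L0 ^^ i) v))"

definition torsion_free :: "(complex \<Rightarrow> 'v::ab_group_add \<Rightarrow> 'v) \<Rightarrow> ('v \<Rightarrow> 'v) \<Rightarrow> bool" where
  "torsion_free sc L0 \<longleftrightarrow> (\<forall>p v. p \<noteq> 0 \<longrightarrow> pact sc L0 p v = 0 \<longrightarrow> v = 0)"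

definition sl2_submodule ::
  "(complex \<Rightarrow> 'v::ab_group_add \<Rightarrow> 'v) \<Rightarrow> ('v \<Rightarrow> 'v) \<Rightarrow> ('v \<Rightarrow> 'v) \<Rightarrow> ('v \<Rightarrow> 'v) \<Rightarrow> 'v set \<Rightarrow> bool" where
  "sl2_submodule sc Lm L0 Lp W \<longleftrightarrow>
     module.subspace sc W \<and> Lm ` W \<subseteq> W \<and> L0 ` W \<subseteq> W \<and> Lp ` W \<subseteq> W"

definition simple_submodule ::
  "(complex \<Rightarrow> 'v::ab_group_add \<Rightarrow> 'v) \<Rightarrow> ('v \<Rightarrow> 'v) \<Rightarrow> ('v \<Rightarrow> 'v) \<Rightarrow> ('v \<Rightarrow> 'v) \<Rightarrow> 'v set \<Rightarrow> bool" where
  "simple_submodule sc Lm L0 Lp W \<longleftrightarrow>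
     sl2_submodule sc Lm L0 Lp W \<and> W \<noteq> {0} \<and>
     (\<forall>U. sl2_submodule sc Lm L0 Lp U \<and> U \<subseteq> W \<longrightarrow> U = {0} \<or> U = W)"

definition simple_sl2_module ::
  "(complex \<Rightarrow> 'v::ab_group_add \<Rightarrow> 'v) \<Rightarrow> ('v \<Rightarrow> 'v) \<Rightarrow> ('v \<Rightarrow> 'v) \<Rightarrow> ('v \<Rightarrow> 'v) \<Rightarrow> bool" where
  "simple_sl2_module sc Lm L0 Lp \<longleftrightarrow> simple_submodule sc Lm L0 Lp UNIV"

text \<open>Essential submodule: V / W is a torsion C[z]-module.\<close>

definition essential_submodule :: "(complex \<Rightarrow> 'v::ab_group_add \<Rightarrow> 'v) \<Rightarrow> ('v \<Rightarrow> 'v) \<Rightarrow> 'v set \<Rightarrow> bool" where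
  "essential_submodule sc L0 W \<longleftrightarrow> (\<forall>v. \<exists>p. p \<noteq> 0 \<and> pact sc L0 p v \<in> W)"

text \<open>The localization S^{-1} V, S = C[z] - {0}: classes of pairs (v, p) (meaning v / p)
under (v,p) ~ (w,q) iff s.(q.v - p.w) = 0 for some s in S.\<close>

definition loc_rel :: "(complex \<Rightarrow> 'v::ab_group_add \<Rightarrow> 'v) \<Rightarrow> ('v \<Rightarrow> 'v) \<Rightarrow> (('v \<times> complex poly) \<times> ('v \<times> complex poly)) set" where
  "loc_rel sc L0 = {((v, p), (w, q)). p \<noteq> 0 \<and> q \<noteq> 0 \<and>
      (\<exists>s. s \<noteq> 0 \<and> pact sc L0 s (pact sc L0 q v - pact sc L0 p w) = 0)}"

definition loc_frac :: "(complex \<Rightarrow> 'v::ab_group_add \<Rightarrow> 'v) \<Rightarrow> ('v \<Rightarrow> 'v) \<Rightarrow> 'v \<Rightarrow> complex poly \<Rightarrow> ('v \<times> complex poly) set" where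
  "loc_frac sc L0 v p = loc_rel sc L0 `` {(v, p)}"

definition loc_carrier :: "(complex \<Rightarrow> 'v::ab_group_add \<Rightarrow> 'v) \<Rightarrow> ('v \<Rightarrow> 'v) \<Rightarrow> ('v \<times> complex poly) set set" where
  "loc_carrier sc L0 = {(v, p). p \<noteq> (0::complex poly)} // loc_rel sc L0"

definition loc_zero :: "(complex \<Rightarrow> 'v::ab_group_add \<Rightarrow> 'v) \<Rightarrow> ('v \<Rightarrow> 'v) \<Rightarrow> ('v \<times> complex poly) set" where
  "loc_zero sc L0 = loc_frac sc L0 0 1"

text \<open>Operations on classes, defined through all representatives (well defined).\<close>

definition loc_add :: "(complex \<Rightarrow> 'v::ab_group_add \<Rightarrow> 'v) \<Rightarrow> ('v \<Rightarrow> 'v) \<Rightarrow>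
    ('v \<times> complex poly) set \<Rightarrow> ('v \<times> complex poly) set \<Rightarrow> ('v \<times> complex poly) set" where
  "loc_add sc L0 X Y = (\<Union>(v, p)\<in>X. \<Union>(w, q)\<in>Y.
      loc_frac sc L0 (pact sc L0 q v + pact sc L0 p w) (p * q))"

definition loc_scale :: "(complex \<Rightarrow> 'v::ab_group_add \<Rightarrow> 'v) \<Rightarrow> ('v \<Rightarrow> 'v) \<Rightarrow>
    complex poly fract \<Rightarrow> ('v \<times> complex poly) set \<Rightarrow> ('v \<times> complex poly) set" where
  "loc_scale sc L0 r X = (\<Union>(v, p)\<in>X. \<Union>(a, b)\<in>{(a, b). b \<noteq> 0 \<and> Fract a b = r}.
      loc_frac sc L0 (pact sc L0 a v) (b * p))"

definition loc_op :: "(complex \<Rightarrow> 'v::ab_group_add \<Rightarrow> 'v) \<Rightarrow> ('v \<Rightarrow> 'v) \<Rightarrow> ('v \<Rightarrow> 'v) \<Rightarrow> complex \<Rightarrow>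
    ('v \<times> complex poly) set \<Rightarrow> ('v \<times> complex poly) set" where
  "loc_op sc L0 A c X = (\<Union>(v, p)\<in>X. loc_frac sc L0 (A v) (pcompose p [:c, 1:]))"

abbreviation rat_Lm where "rat_Lm sc Lm L0 \<equiv> loc_op sc L0 Lm (-1)"
abbreviation rat_Lp where "rat_Lp sc Lp L0 \<equiv> loc_op sc L0 Lp 1"
abbreviation rat_L0 where "rat_L0 sc L0 \<equiv> loc_op sc L0 L0 0"

definition rat_subspace :: "(complex \<Rightarrow> 'v::ab_group_add \<Rightarrow> 'v) \<Rightarrow> ('v \<Rightarrow> 'v) \<Rightarrow> ('v \<times> complex poly) set set \<Rightarrow> bool" where
  "rat_subspace sc L0 W \<longleftrightarrow> W \<subseteq> loc_carrier sc L0 \<and> loc_zero sc L0 \<in> W \<and>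
     (\<forall>X\<in>W. \<forall>Y\<in>W. loc_add sc L0 X Y \<in> W) \<and> (\<forall>r. \<forall>X\<in>W. loc_scale sc L0 r X \<in> W)"

definition rat_span :: "(complex \<Rightarrow> 'v::ab_group_add \<Rightarrow> 'v) \<Rightarrow> ('v \<Rightarrow> 'v) \<Rightarrow> ('v \<times> complex poly) set set \<Rightarrow> ('v \<times> complex poly) set set" where
  "rat_span sc L0 B = \<Inter>{W. B \<subseteq> W \<and> rat_subspace sc L0 W}"

definition finite_rank :: "(complex \<Rightarrow> 'v::ab_group_add \<Rightarrow> 'v) \<Rightarrow> ('v \<Rightarrow> 'v) \<Rightarrow> bool" where
  "finite_rank sc L0 \<longleftrightarrow> (\<exists>B. finite B \<and> B \<subseteq> loc_carrier sc L0 \<and> loc_carrier sc L0 \<subseteq> rat_span sc L0 B)"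

definition rat_irreducible ::
  "(complex \<Rightarrow> 'v::ab_group_add \<Rightarrow> 'v) \<Rightarrow> ('v \<Rightarrow> 'v) \<Rightarrow> ('v \<Rightarrow> 'v) \<Rightarrow> ('v \<Rightarrow> 'v) \<Rightarrow> bool" where
  "rat_irreducible sc Lm L0 Lp \<longleftrightarrow>
     loc_carrier sc L0 \<noteq> {loc_zero sc L0} \<and>
     (\<forall>W. rat_subspace sc L0 W \<and>
          (\<forall>X\<in>W. rat_Lm sc Lm L0 X \<in> W \<and> rat_L0 sc L0 X \<in> W \<and> rat_Lp sc Lp L0 X \<in> W)
        \<longrightarrow> W = {loc_zero sc L0} \<or> W = loc_carrier sc L0)"

end

theory Submission
  imports Defs "HOL-Computational_Algebra.Fundamental_Theorem_Algebra"
begin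

text \<open>If \<open>V\<close> is simple, an \<open>sl(2)\<close>-invariant subspace \<open>W\<close> of the localization is determined by
  \<open>W \<inter> V\<close>, which is \<open>0\<close> or \<open>V\<close>.

  Conversely, irreducibility of the localization makes every nonzero submodule of \<open>V\<close> essential, so
  it suffices that all essential submodules share a nonzero element: their intersection is then the
  unique simple submodule. The operators \<open>L\<^sub>1\<close> and \<open>L\<^sub>-\<^sub>1\<close> are semilinear over \<open>\<complex>[z]\<close> for the shifts
  \<open>z \<mapsto> z \<plusminus> 1\<close> and, by finite rank, injective. So for a finitely generated full rank \<open>\<complex>[z]\<close>-submodule
  \<open>L\<close> there are nonzero \<open>h\<close>, \<open>h'\<close> with \<open>h L \<subseteq> L\<^sub>1 L\<close> and \<open>h' L \<subseteq> L\<^sub>-\<^sub>1 L\<close>. If \<open>q\<close> generates the ideal of all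
  polynomials mapping \<open>L\<close> into an essential submodule, then \<open>q(z)\<close> divides \<open>q(z + 1) h(z)\<close> and
  \<open>q(z - 1) h'(z)\<close>, and this forces \<open>q\<close> to divide a polynomial \<open>d\<close> depending only on \<open>h\<close> and \<open>h'\<close>.
  Hence \<open>d L\<close> lies in every essential submodule.\<close>

section \<open>Linear dependence over a domain\<close>

text \<open>Fraction-free Gaussian elimination: a pivot row \<open>k\<close> with a nonzero entry in
  column \<open>j\<close> is removed together with that column.\<close>

lemma overdetermined_relation:
  fixes a :: "'i \<Rightarrow> 'j \<Rightarrow> 'a::idom"
  assumes "finite J" "finite S" "card J < card S"
  shows "\<exists>c. (\<exists>i\<in>S. c i \<noteq> 0) \<and> (\<forall>j\<in>J. (\<Sum>i\<in>S. c i * a i j) = 0)"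
  using assms
proof (induction J arbitrary: S a rule: finite_induct)
  case empty
  then have "S \<noteq> {}" by auto
  then show ?case by (intro exI[of _ "\<lambda>_. 1"]) auto
next
  case (insert j J)
  show ?case
  proof (cases "\<forall>i\<in>S. a i j = 0")
    case True
    obtain c where "\<exists>i\<in>S. c i \<noteq> 0" "\<forall>j\<in>J. (\<Sum>i\<in>S. c i * a i j) = 0"
      using insert.IH[of S a] insert.prems insert.hyps by auto
    then show ?thesis using True by (intro exI[of _ c]) auto
  next
    case False
    then obtain k where k: "k \<in> S" "a k j \<noteq> 0" by blast
    define T where "T = S - {k}"
    have T: "finite T" "k \<notin> T" "S = insert k T"
      using k insert.prems by (auto simp: T_def)
    then have "card J < card T" using insert.prems insert.hyps by simp
    then obtain c where c: "\<exists>i\<in>T. c i \<noteq> 0"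
        "\<forall>j'\<in>J. (\<Sum>i\<in>T. c i * (a k j * a i j' - a i j * a k j')) = 0"
      using insert.IH[of T "\<lambda>i j'. a k j * a i j' - a i j * a k j'"] T by auto
    \<comment> \<open>The coefficient of the pivot row is chosen to cancel column \<open>j\<close>;
      scaling the others by the pivot keeps a nonzero one nonzero.\<close>
    define d where "d i = (if i = k then - (\<Sum>i\<in>T. c i * a i j) else c i * a k j)" for i
    have dk: "d k = - (\<Sum>i\<in>T. c i * a i j)" by (simp add: d_def)
    have dT: "(\<Sum>i\<in>T. d i * a i j') = (\<Sum>i\<in>T. c i * a k j * a i j')" for j'
      using T by (intro sum.cong) (auto simp: d_def)
    have "(\<Sum>i\<in>S. d i * a i j') = (\<Sum>i\<in>T. c i * (a k j * a i j' - a i j * a k j'))" for j'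
      using T by (simp add: dk dT sum_distrib_left sum_subtractf algebra_simps)
    then have "\<forall>j'\<in>insert j J. (\<Sum>i\<in>S. d i * a i j') = 0"
      using c(2) by (auto simp: mult.commute)
    moreover have "\<exists>i\<in>S. d i \<noteq> 0" using c(1) k T by (auto simp: d_def)
    ultimately show ?thesis by blast
  qed
qed

section \<open>Orders of roots along shift orbits\<close>

text \<open>Substituting \<open>z + c\<close> for \<open>z\<close> is a ring automorphism that
  carries the linear factor at \<open>x + c\<close> to the one at \<open>x\<close>.\<close>

lemma order_pcompose_shift:
  fixes p :: "'a::idom poly"
  assumes "p \<noteq> 0"
  shows "order x (pcompose p [:c, 1:]) = order (x + c) p"
proof (rule order_unique_lemma)
  have pow: "pcompose (r ^ n) s = pcompose r s ^ n" for r s :: "'a poly" and n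
    by (induction n) (simp_all add: pcompose_mult pcompose_1)
  have lin: "pcompose ([:- (x + c), 1:] ^ n) [:c, 1:] = [:- x, 1:] ^ n" for n
    by (simp add: pow pcompose_pCons)
  have lin': "pcompose ([:- x, 1:] ^ n) [:- c, 1:] = [:- (x + c), 1:] ^ n" for n
    by (simp add: pow pcompose_pCons)
  have inv: "pcompose (pcompose p [:c, 1:]) [:- c, 1:] = p"
    by (simp add: pcompose_assoc[symmetric] pcompose_pCons)
  show "[:- x, 1:] ^ order (x + c) p dvd pcompose p [:c, 1:]"
    using order_1[of "x + c" p] unfolding lin[symmetric] dvd_def by (metis pcompose_mult)
  show "\<not> [:- x, 1:] ^ Suc (order (x + c) p) dvd pcompose p [:c, 1:]"
  proof
    assume "[:- x, 1:] ^ Suc (order (x + c) p) dvd pcompose p [:c, 1:]"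
    then have "pcompose ([:- x, 1:] ^ Suc (order (x + c) p)) [:- c, 1:] dvd pcompose (pcompose p [:c, 1:]) [:- c, 1:]"
      unfolding dvd_def by (metis pcompose_mult)
    then show False using order_2[OF assms, of "x + c"] unfolding lin' inv by blast
  qed
qed

lemma sum_order_subset_le_degree:
  fixes p :: "'a::idom poly"
  assumes "p \<noteq> 0" "finite S"
  shows "(\<Sum>x\<in>S. order x p) \<le> degree p"
proof -
  have "(\<Sum>x\<in>S. order x p) = (\<Sum>x\<in>S \<inter> {x. poly p x = 0}. order x p)"
    using assms by (intro sum.mono_neutral_right) (auto simp: order_root)
  also have "\<dots> \<le> (\<Sum>x | poly p x = 0. order x p)"
    using poly_roots_finite[OF assms(1)] by (intro sum_mono2) auto
  also have "\<dots> \<le> degree p" by (rule sum_order_le_degree[OF assms(1)])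
  finally show ?thesis .
qed

text \<open>Along each orbit of the shift, the first divisibility lets the order of \<open>q\<close> increase in one
  direction only at roots of \<open>h\<close>, the second one in the other direction only at roots of \<open>h'\<close>.
  As \<open>q\<close> has finitely many roots, all of them lie between a root of \<open>h'\<close> and a root of \<open>h\<close>.\<close>

lemma bounded_by_shift_divisibility:
  fixes h h' :: "complex poly"
  assumes "h \<noteq> 0" "h' \<noteq> 0"
  shows "\<exists>d. d \<noteq> 0 \<and> (\<forall>q. q \<noteq> 0 \<longrightarrow> q dvd pcompose q [:1, 1:] * h
    \<longrightarrow> q dvd pcompose q [:-1, 1:] * h' \<longrightarrow> q dvd d)"
proof -
  have shift0: "pcompose q [:c, 1:] \<noteq> 0" if "q \<noteq> 0" for q :: "complex poly" and c
    using that by (simp add: pcompose_eq_0_iff)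
  have order_step: "order x q \<le> order (x + c) q + order x g"
    if "q \<noteq> 0" "g \<noteq> 0" "q dvd pcompose q [:c, 1:] * g" for q g :: "complex poly" and x c
    using dvd_imp_order_le[OF _ that(3), of x] that shift0[OF that(1), of c]
    by (simp add: order_mult order_pcompose_shift)
  have order_sum: "order x q \<le> (\<Sum>i<k. order (x + of_nat i * c) g) + order (x + of_nat k * c) q"
    if "q \<noteq> 0" "g \<noteq> 0" "q dvd pcompose q [:c, 1:] * g" for q g :: "complex poly" and x c k
  proof (induction k)
    case 0
    then show ?case by simp
  next
    case (Suc k)
    have "order (x + of_nat k * c) q \<le> order (x + of_nat (Suc k) * c) q + order (x + of_nat k * c) g"
      using order_step[OF that, of "x + of_nat k * c"] by (simp add: algebra_simps)
    then show ?case using Suc by simp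
  qed
  \<comment> \<open>The orbit of \<open>x\<close> is infinite as \<open>c\<close> is nonzero, so it
    leaves the finite root set of \<open>q\<close> at some step \<open>k\<close>, and the last term
    of \<open>order_sum\<close> vanishes.\<close>
  have order_bound: "\<exists>k. order x q \<le> (\<Sum>i<k. order (x + of_nat i * c) g)"
    if "q \<noteq> 0" "g \<noteq> 0" "q dvd pcompose q [:c, 1:] * g" "c \<noteq> 0" for q g :: "complex poly" and x c
  proof -
    have "inj (\<lambda>k::nat. x + of_nat k * c)" using that(4) by (auto simp: inj_on_def)
    then have "infinite (range (\<lambda>k::nat. x + of_nat k * c))" by (rule range_inj_infinite)
    then have "\<not> range (\<lambda>k::nat. x + of_nat k * c) \<subseteq> {x. poly q x = 0}"
      using finite_subset[OF _ poly_roots_finite[OF \<open>q \<noteq> 0\<close>]] by blast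
    then obtain k :: nat where "poly q (x + of_nat k * c) \<noteq> 0" by blast
    then have "order (x + of_nat k * c) q = 0" by (rule order_0I)
    then show ?thesis using order_sum[OF that(1-3), of x k] by auto
  qed
  have forward_root: "\<exists>i::nat. poly g (x + of_nat i * c) = 0"
    if q: "q \<noteq> 0" "g \<noteq> 0" "q dvd pcompose q [:c, 1:] * g" "c \<noteq> 0" "poly q x = 0"
    for q g :: "complex poly" and x c
  proof (rule ccontr)
    assume "\<not> ?thesis"
    then have "order (x + of_nat i * c) g = 0" for i :: nat by (intro order_0I) auto
    then have "order x q = 0" using order_bound[OF q(1-4), of x] by auto
    then show False using q(1,5) by (simp add: order_root)
  qed
  define F where "F = {x. (\<exists>i::nat. poly h (x + of_nat i) = 0) \<and> (\<exists>j::nat. poly h' (x - of_nat j) = 0)}"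
  \<comment> \<open>A point of \<open>F\<close> is \<open>r - i\<close> for roots \<open>r\<close>
    of \<open>h\<close> and \<open>r'\<close> of \<open>h'\<close> with
    \<open>r - r' = i + j\<close>; each pair of roots admits only finitely many
    \<open>i\<close>.\<close>
  have "F \<subseteq> (\<Union>r\<in>{r. poly h r = 0}. \<Union>r'\<in>{r. poly h' r = 0}.
     (\<lambda>i::nat. r - of_nat i) ` {i. \<exists>j::nat. r - r' = of_nat (i + j)})" (is "_ \<subseteq> ?G")
  proof
    fix x assume "x \<in> F"
    then obtain i j where "poly h (x + of_nat i) = 0" "poly h' (x - of_nat j) = 0"
      by (auto simp: F_def)
    then show "x \<in> ?G"
      by (intro UN_I[of "x + of_nat i"] UN_I[of "x - of_nat j"] image_eqI[of _ _ i])
         (auto intro!: exI[of _ j])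
  qed
  moreover have "finite {i::nat. \<exists>j::nat. (z::complex) = of_nat (i + j)}" for z
  proof (cases "\<exists>n::nat. z = of_nat n")
    case True
    then obtain n where "z = of_nat n" by blast
    then have "{i::nat. \<exists>j::nat. z = of_nat (i + j)} \<subseteq> {..n}"
      by (auto simp flip: of_nat_add simp: of_nat_eq_iff)
    then show ?thesis by (rule finite_subset) simp
  next
    case False
    then have "{i::nat. \<exists>j::nat. z = of_nat (i + j)} = {}" by blast
    then show ?thesis by (metis finite.emptyI)
  qed
  then have "finite ?G" using assms by (intro finite_UN_I finite_imageI poly_roots_finite) auto
  ultimately have F: "finite F" by (rule finite_subset)
  \<comment> \<open>The exponent is \<open>degree h\<close> because the order of \<open>q\<close> at
    a point is at most a sum of orders of \<open>h\<close> at distinct points.\<close>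
  define d where "d = (\<Prod>x\<in>F. [:- x, 1:] ^ degree h)"
  have "q dvd d" if q: "q \<noteq> 0" "q dvd pcompose q [:1, 1:] * h" "q dvd pcompose q [:-1, 1:] * h'"
    for q
  proof -
    have "x \<in> F" if "poly q x = 0" for x
      using forward_root[OF q(1) assms(1) q(2) _ that] forward_root[OF q(1) assms(2) q(3) _ that]
      by (auto simp: F_def)
    then have root: "{x. poly q x = 0} \<subseteq> F" by blast
    have "order x q \<le> degree h" for x
    proof -
      obtain k where "order x q \<le> (\<Sum>i<k. order (x + of_nat i) h)"
        using order_bound[OF q(1) assms(1) q(2), of x] by auto
      also have "\<dots> = (\<Sum>y\<in>(\<lambda>i. x + of_nat i) ` {..<k}. order y h)"
        by (subst sum.reindex) (auto simp: inj_on_def)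
      also have "\<dots> \<le> degree h" using assms(1) by (intro sum_order_subset_le_degree) auto
      finally show ?thesis .
    qed
    then have "(\<Prod>x\<in>{x. poly q x = 0}. [:- x, 1:] ^ order x q) dvd (\<Prod>x\<in>{x. poly q x = 0}. [:- x, 1:] ^ degree h)"
      by (intro prod_dvd_prod le_imp_power_dvd) auto
    also have "\<dots> dvd d" unfolding d_def using root F by (intro prod_dvd_prod_subset)
    finally have "(\<Prod>x\<in>{x. poly q x = 0}. [:- x, 1:] ^ order x q) dvd d" .
    then have "smult (lead_coeff q) (\<Prod>x\<in>{x. poly q x = 0}. [:- x, 1:] ^ order x q) dvd d"
      using q(1) by (intro smult_dvd) auto
    then show ?thesis by (simp only: complex_poly_decompose)
  qed
  moreover have "d \<noteq> 0" using F by (auto simp: d_def)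
  ultimately show ?thesis by blast
qed

section \<open>The polynomial action and shift-semilinear operators\<close>

abbreviation shift :: "complex \<Rightarrow> complex poly \<Rightarrow> complex poly" where
  "shift c p \<equiv> pcompose p [:c, 1:]"

lemma shift_eq_0_iff: "shift c p = 0 \<longleftrightarrow> p = 0"
  by (simp add: pcompose_eq_0_iff)

lemma shift_shift: "shift c (shift d p) = shift (c + d) p"
  by (simp add: pcompose_assoc[symmetric] pcompose_pCons add.commute)

locale operator_space = vector_space sc
  for sc :: "complex \<Rightarrow> 'v::ab_group_add \<Rightarrow> 'v" +
  fixes L0 :: "'v \<Rightarrow> 'v"
  assumes linear_L0: "Vector_Spaces.linear sc sc L0"
begin

abbreviation act :: "complex poly \<Rightarrow> 'v \<Rightarrow> 'v" (infixr "\<odot>" 75) where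
  "p \<odot> v \<equiv> pact sc L0 p v"

lemma L0_add: "L0 (v + w) = L0 v + L0 w"
  and L0_scale: "L0 (sc a v) = sc a (L0 v)"
  using linear_L0 by (auto simp: Vector_Spaces.linear_def module_hom_def module_hom_axioms_def)

sublocale L0: additive L0
  by standard (rule L0_add)

lemma act_0: "0 \<odot> v = 0"
  by (simp add: pact_def)

lemma act_pCons: "pCons a p \<odot> v = sc a v + L0 (p \<odot> v)"
proof (cases "p = 0")
  case True
  then show ?thesis by (simp add: pact_def L0.zero)
next
  case False
  then show ?thesis
    by (simp add: pact_def sum.atMost_Suc_shift L0.sum L0_scale del: sum.atMost_Suc)
qed

lemma act_const: "[:a:] \<odot> v = sc a v"
  by (simp add: act_pCons act_0 L0.zero)

lemma act_X: "[:0, 1:] \<odot> v = L0 v"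
  by (simp add: act_pCons act_0 L0.zero)

lemma act_add_right: "p \<odot> (v + w) = p \<odot> v + p \<odot> w"
  by (induction p) (simp_all add: act_0 act_pCons L0_add scale_right_distrib algebra_simps)

lemma act_add_left: "(p + q) \<odot> v = p \<odot> v + q \<odot> v"
  by (induction p q rule: poly_induct2)
     (simp_all add: act_0 act_pCons L0_add scale_left_distrib algebra_simps)

lemma act_smult: "smult a p \<odot> v = sc a (p \<odot> v)"
  by (induction p) (simp_all add: act_0 act_pCons L0_scale scale_right_distrib)

lemma act_mult: "(p * q) \<odot> v = p \<odot> q \<odot> v"
  by (induction p) (simp_all add: act_0 act_pCons act_add_left act_smult)

text \<open>From here on, \<open>P.subspace\<close> and \<open>P.span\<close> refer to
  \<complex>[z]-submodules, whereas the unqualified \<open>subspace\<close> is over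
  \<complex>.\<close>

sublocale P: module "pact sc L0"
  by standard (simp_all add: act_add_right act_add_left act_mult act_const one_pCons)

lemma P_subspace_iff: "P.subspace U \<longleftrightarrow> subspace U \<and> L0 ` U \<subseteq> U"
proof safe
  assume U: "P.subspace U"
  show "subspace U"
    using U by (auto simp: subspace_def P.subspace_def act_const[symmetric])
  show "L0 v \<in> U" if "v \<in> U" for v
    using U that by (auto simp: P.subspace_def act_X[symmetric])
next
  assume U: "subspace U" "L0 ` U \<subseteq> U"
  have "p \<odot> v \<in> U" if "v \<in> U" for p v
    using that U by (induction p) (auto simp: act_0 act_pCons subspace_def)
  then show "P.subspace U" using U by (auto simp: P.subspace_def subspace_def)
qed

lemma sl2_submodule_iff:
  "sl2_submodule sc Lm L0 Lp U \<longleftrightarrow> P.subspace U \<and> Lm ` U \<subseteq> U \<and> Lp ` U \<subseteq> U"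
  by (auto simp: sl2_submodule_def P_subspace_iff)

text \<open>The number \<open>c\<close> encodes the commutation rule
  \<open>A L0 = (L0 + c) A\<close>: it is \<open>1\<close> for \<open>Lp\<close>, \<open>-1\<close>
  for \<open>Lm\<close> and \<open>0\<close> for \<open>L0\<close> itself.\<close>

definition semilinear :: "('v \<Rightarrow> 'v) \<Rightarrow> complex \<Rightarrow> bool" where
  "semilinear A c \<longleftrightarrow> (\<forall>v w. A (v + w) = A v + A w) \<and> (\<forall>p v. A (p \<odot> v) = shift c p \<odot> A v)"

lemma semilinear_add: "semilinear A c \<Longrightarrow> A (v + w) = A v + A w"
  and semilinear_act: "semilinear A c \<Longrightarrow> A (p \<odot> v) = shift c p \<odot> A v"
  by (simp_all add: semilinear_def)

lemma semilinear_additive: "semilinear A c \<Longrightarrow> additive A"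
  by (simp add: additive_def semilinear_add)

lemma semilinearI:
  assumes "Vector_Spaces.linear sc sc A" "\<And>v. A (L0 v) = L0 (A v) + sc c (A v)"
  shows "semilinear A c"
proof -
  have A: "A (v + w) = A v + A w" "A (sc a v) = sc a (A v)" for v w a
    using assms(1) by (auto simp: Vector_Spaces.linear_def module_hom_def module_hom_axioms_def)
  then interpret A: additive A by (simp add: additive_def)
  have "A (p \<odot> v) = shift c p \<odot> A v" for p v
  proof (induction p)
    case 0
    then show ?case by (simp add: act_0 A.zero)
  next
    case (pCons a p)
    then show ?case
      by (simp add: act_pCons A assms(2) pcompose_pCons act_add_left act_smult act_0 L0.zero algebra_simps)
  qed
  then show ?thesis by (simp add: semilinear_def A)
qed

lemma semilinear_image_subspace:
  assumes "semilinear A c" "P.subspace U"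
  shows "P.subspace (A ` U)"
proof -
  interpret A: additive A using assms(1) by (rule semilinear_additive)
  \<comment> \<open>Shifting the scalar back by \<open>- c\<close> moves it inside \<open>A\<close>,
    which makes the image stable.\<close>
  have "p \<odot> A u = A (shift (- c) p \<odot> u)" for p u
    by (simp add: semilinear_act[OF assms(1)] shift_shift)
  moreover have "0 \<in> A ` U"
    using A.zero assms(2) by (metis P.subspace_0 imageI)
  ultimately show ?thesis
    using assms(2) by (auto simp: P.subspace_def A.add[symmetric])
qed

text \<open>The product of the multipliers of the finitely many generators works for each of them,
  and the vectors it sends into \<open>N\<close> form a submodule.\<close>

lemma span_common_multiple:
  assumes "P.subspace N" "finite F" "\<And>v. v \<in> F \<Longrightarrow> \<exists>h. h \<noteq> 0 \<and> h \<odot> v \<in> N"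
  shows "\<exists>h. h \<noteq> 0 \<and> (\<forall>v\<in>P.span F. h \<odot> v \<in> N)"
proof -
  obtain h where h: "\<And>v. v \<in> F \<Longrightarrow> h v \<noteq> 0 \<and> h v \<odot> v \<in> N" using assms(3) by metis
  define g where "g = prod h F"
  have "g \<odot> v \<in> N" if "v \<in> F" for v
  proof -
    have "g = prod h (F - {v}) * h v" using that assms(2) by (simp add: g_def prod.remove)
    then have "g \<odot> v = prod h (F - {v}) \<odot> h v \<odot> v" by simp
    then show ?thesis using h[OF that] assms(1) by (metis P.subspace_scale)
  qed
  moreover have "P.subspace {v. g \<odot> v \<in> N}"
  proof (rule P.subspaceI)
    show "p \<odot> v \<in> {v. g \<odot> v \<in> N}" if "v \<in> {v. g \<odot> v \<in> N}" for p v
      using that P.subspace_scale[OF assms(1)] P.scale_left_commute[of g p v] by (metis mem_Collect_eq)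
  qed (use assms(1) in \<open>auto simp: act_add_right P.subspace_0 P.subspace_add\<close>)
  ultimately have "\<forall>v\<in>P.span F. g \<odot> v \<in> N" using P.span_minimal[of F "{v. g \<odot> v \<in> N}"] by auto
  moreover have "g \<noteq> 0" using h assms(2) by (simp add: g_def)
  ultimately show ?thesis by blast
qed

end

section \<open>Localization of a torsion free module\<close>

locale torsion_free_space = operator_space sc L0
  for sc :: "complex \<Rightarrow> 'v::ab_group_add \<Rightarrow> 'v" and L0 :: "'v \<Rightarrow> 'v" +
  assumes torsion_free: "torsion_free sc L0"
begin

lemma act_eq_0_iff: "p \<odot> v = 0 \<longleftrightarrow> p = 0 \<or> v = 0"
  using torsion_free by (auto simp: torsion_free_def act_0)

lemma act_cancel: "p \<noteq> 0 \<Longrightarrow> p \<odot> v = p \<odot> w \<longleftrightarrow> v = w"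
  using act_eq_0_iff[of p "v - w"] by (simp add: P.scale_right_diff_distrib)

abbreviation frac :: "'v \<Rightarrow> complex poly \<Rightarrow> ('v \<times> complex poly) set" where
  "frac \<equiv> loc_frac sc L0"

text \<open>Torsion freeness cancels the factor \<open>s\<close> in \<open>loc_rel\<close>, leaving
  plain cross multiplication.\<close>

lemma loc_rel_iff:
  "((v, p), (w, q)) \<in> loc_rel sc L0 \<longleftrightarrow> p \<noteq> 0 \<and> q \<noteq> 0 \<and> q \<odot> v = p \<odot> w"
  by (auto simp: loc_rel_def act_eq_0_iff intro: exI[of _ 1])

lemma equiv_loc_rel: "equiv {(v, p). p \<noteq> 0} (loc_rel sc L0)"
proof (rule equivI)
  show "loc_rel sc L0 \<subseteq> {(v, p). p \<noteq> 0} \<times> {(v, p). p \<noteq> 0}"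
    by (auto simp: loc_rel_iff)
  show "refl_on {(v, p). p \<noteq> 0} (loc_rel sc L0)"
    by (auto simp: refl_on_def loc_rel_iff)
  show "sym (loc_rel sc L0)" by (auto simp: sym_def loc_rel_iff)
  show "trans (loc_rel sc L0)"
  proof (rule transI, clarify)
    fix u p v q w r
    assume "((u, p), (v, q)) \<in> loc_rel sc L0" "((v, q), (w, r)) \<in> loc_rel sc L0"
    then have *: "p \<noteq> 0" "q \<noteq> 0" "r \<noteq> 0" "q \<odot> u = p \<odot> v" "r \<odot> v = q \<odot> w"
      by (auto simp: loc_rel_iff)
    have "q \<odot> r \<odot> u = q \<odot> p \<odot> w"
      using *(4,5) by (metis P.scale_left_commute)
    then have "r \<odot> u = p \<odot> w" using act_cancel[OF *(2)] by blast
    then show "((u, p), (w, r)) \<in> loc_rel sc L0" using * by (simp add: loc_rel_iff)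
  qed
qed

lemma frac_eq_iff: "p \<noteq> 0 \<Longrightarrow> q \<noteq> 0 \<Longrightarrow> frac v p = frac w q \<longleftrightarrow> q \<odot> v = p \<odot> w"
  unfolding loc_frac_def using equiv_loc_rel by (subst eq_equiv_class_iff) (auto simp: loc_rel_iff)

lemma mem_frac_iff: "(w, q) \<in> frac v p \<longleftrightarrow> p \<noteq> 0 \<and> q \<noteq> 0 \<and> q \<odot> v = p \<odot> w"
  by (simp add: loc_frac_def loc_rel_iff)

lemma loc_carrier_iff: "X \<in> loc_carrier sc L0 \<longleftrightarrow> (\<exists>v p. p \<noteq> 0 \<and> X = frac v p)"
  by (auto simp: loc_carrier_def quotient_def loc_frac_def)

lemma frac_eq_zero_iff: "p \<noteq> 0 \<Longrightarrow> frac v p = loc_zero sc L0 \<longleftrightarrow> v = 0"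
  by (simp add: loc_zero_def frac_eq_iff)

text \<open>The union in \<open>loc_op\<close> collapses to one class, since \<open>A\<close> turns
  the relation between two representatives into its shifted counterpart. Sums and scalar multiples
  below collapse in the same way.\<close>

lemma frac_op:
  assumes "semilinear A c" "p \<noteq> 0"
  shows "loc_op sc L0 A c (frac v p) = frac (A v) (shift c p)"
proof -
  have "frac (A w) (shift c q) = frac (A v) (shift c p)" if "(w, q) \<in> frac v p" for w q
    using that assms(2)
    by (subst frac_eq_iff) (auto simp: mem_frac_iff shift_eq_0_iff semilinear_act[OF assms(1), symmetric])
  moreover have "(v, p) \<in> frac v p" using assms by (simp add: mem_frac_iff)
  ultimately show ?thesis unfolding loc_op_def by blast
qed

lemma frac_add:
  assumes "p \<noteq> 0" "q \<noteq> 0"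
  shows "loc_add sc L0 (frac v p) (frac w q) = frac (q \<odot> v + p \<odot> w) (p * q)"
proof -
  have "frac (q' \<odot> v' + p' \<odot> w') (p' * q') = frac (q \<odot> v + p \<odot> w) (p * q)"
    if "(v', p') \<in> frac v p" "(w', q') \<in> frac w q" for v' p' w' q'
  proof -
    have *: "p' \<noteq> 0" "q' \<noteq> 0" "p \<odot> v' = p' \<odot> v" "q \<odot> w' = q' \<odot> w"
      using that by (auto simp: mem_frac_iff)
    have "(p * q) \<odot> (q' \<odot> v' + p' \<odot> w') = (q * q') \<odot> p \<odot> v' + (p * p') \<odot> q \<odot> w'"
      by (simp add: act_add_right mult_ac)
    also have "\<dots> = (p' * q') \<odot> (q \<odot> v + p \<odot> w)"
      unfolding * by (simp add: act_add_right mult_ac)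
    finally show ?thesis using * assms by (simp add: frac_eq_iff)
  qed
  moreover have "(v, p) \<in> frac v p" "(w, q) \<in> frac w q" using assms by (simp_all add: mem_frac_iff)
  ultimately show ?thesis unfolding loc_add_def by blast
qed

lemma frac_scale:
  assumes "p \<noteq> 0" "b \<noteq> 0"
  shows "loc_scale sc L0 (Fract a b) (frac v p) = frac (a \<odot> v) (b * p)"
proof -
  have "frac (a' \<odot> v') (b' * p') = frac (a \<odot> v) (b * p)"
    if "(v', p') \<in> frac v p" "b' \<noteq> 0" "Fract a' b' = Fract a b" for v' p' a' b'
  proof -
    have *: "p' \<noteq> 0" "p \<odot> v' = p' \<odot> v" "a' * b = a * b'"
      using that assms by (auto simp: mem_frac_iff eq_fract)
    have "(b * p) \<odot> a' \<odot> v' = (a' * b) \<odot> p \<odot> v'"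
      by (simp add: mult_ac)
    also have "\<dots> = (b' * p') \<odot> a \<odot> v"
      unfolding * by (simp add: mult_ac)
    finally show ?thesis using * assms that(2) by (simp add: frac_eq_iff)
  qed
  moreover have "(v, p) \<in> frac v p" using assms by (simp add: mem_frac_iff)
  ultimately show ?thesis unfolding loc_scale_def using assms(2) by blast
qed

lemma fractions_rat_subspace:
  assumes "P.subspace U"
  shows "rat_subspace sc L0 {frac v p |v p. v \<in> U \<and> p \<noteq> 0}"
proof -
  define W where "W = {frac v p |v p. v \<in> U \<and> p \<noteq> 0}"
  have WI: "frac v p \<in> W" if "v \<in> U" "p \<noteq> 0" for v p using that unfolding W_def by blast
  have WE: "\<exists>v p. v \<in> U \<and> p \<noteq> 0 \<and> X = frac v p" if "X \<in> W" for X
    using that unfolding W_def by blast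
  have "loc_zero sc L0 \<in> W"
    unfolding loc_zero_def using assms by (intro WI) (auto simp: P.subspace_0)
  moreover have "loc_add sc L0 X Y \<in> W" if "X \<in> W" "Y \<in> W" for X Y
    using WE[OF that(1)] WE[OF that(2)] assms
    by (auto simp: frac_add P.subspace_add P.subspace_scale intro!: WI)
  moreover have "loc_scale sc L0 r X \<in> W" if "X \<in> W" for r X
    using WE[OF that] assms by (cases r) (auto simp: frac_scale P.subspace_scale intro!: WI)
  moreover have "W \<subseteq> loc_carrier sc L0" using WE by (force simp: loc_carrier_iff)
  ultimately show ?thesis unfolding W_def[symmetric] by (simp add: rat_subspace_def)
qed

end

section \<open>Finite rank: dependence, injectivity and uniform multipliers\<close>

locale finite_rank_space = torsion_free_space +
  assumes finite_rank: "finite_rank sc L0"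
begin

text \<open>Numerators of a finite spanning set \<open>B\<close> of the localization suffice: the
  vectors that are torsion modulo their span form a submodule whose localization contains
  \<open>B\<close>, hence everything.\<close>

lemma finite_full_rank_set:
  obtains F where "finite F" "\<And>v. \<exists>s. s \<noteq> 0 \<and> s \<odot> v \<in> P.span F"
proof -
  obtain B where B: "finite B" "B \<subseteq> loc_carrier sc L0" "loc_carrier sc L0 \<subseteq> rat_span sc L0 B"
    using finite_rank by (auto simp: finite_rank_def)
  then have "\<forall>X\<in>B. \<exists>v p. p \<noteq> 0 \<and> X = frac v p" by (auto simp: loc_carrier_iff)
  then obtain f g where fg: "\<And>X. X \<in> B \<Longrightarrow> g X \<noteq> 0 \<and> X = frac (f X) (g X)" by metis
  define U where "U = {v. \<exists>s. s \<noteq> 0 \<and> s \<odot> v \<in> P.span (f ` B)}"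
  have "P.subspace U"
  proof (rule P.subspaceI)
    show "0 \<in> U" unfolding U_def using P.span_zero by (auto intro: exI[of _ 1])
    show "p \<odot> v \<in> U" if "v \<in> U" for p v
      using that unfolding U_def mem_Collect_eq by (metis P.scale_left_commute P.span_scale)
    show "v + w \<in> U" if vw: "v \<in> U" "w \<in> U" for v w
    proof -
      obtain s t where st: "s \<noteq> 0" "t \<noteq> 0" "s \<odot> v \<in> P.span (f ` B)" "t \<odot> w \<in> P.span (f ` B)"
        using vw by (auto simp: U_def)
      have "(s * t) \<odot> (v + w) = t \<odot> s \<odot> v + s \<odot> t \<odot> w"
        by (simp add: act_add_right mult_ac)
      then have "(s * t) \<odot> (v + w) \<in> P.span (f ` B)"
        using st by (metis P.span_add P.span_scale)
      then show ?thesis using st by (auto simp: U_def intro!: exI[of _ "s * t"])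
    qed
  qed
  then have "rat_subspace sc L0 {frac v p |v p. v \<in> U \<and> p \<noteq> 0}" by (rule fractions_rat_subspace)
  moreover have "f X \<in> U" if "X \<in> B" for X
    unfolding U_def using that P.span_base[of "f X" "f ` B"] by (auto intro!: exI[of _ 1])
  then have "B \<subseteq> {frac v p |v p. v \<in> U \<and> p \<noteq> 0}" using fg by blast
  ultimately have *: "loc_carrier sc L0 \<subseteq> {frac v p |v p. v \<in> U \<and> p \<noteq> 0}"
    using B(3) unfolding rat_span_def by blast
  have "\<exists>s. s \<noteq> 0 \<and> s \<odot> v \<in> P.span (f ` B)" for v
  proof -
    have "frac v 1 \<in> loc_carrier sc L0" unfolding loc_carrier_iff by (intro exI conjI) auto
    then obtain w p where w: "w \<in> U" "p \<noteq> 0" "frac v 1 = frac w p" using * by blast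
    then have "p \<odot> v = w" by (simp add: frac_eq_iff)
    moreover obtain s where "s \<noteq> 0" "s \<odot> w \<in> P.span (f ` B)" using w(1) by (auto simp: U_def)
    ultimately show ?thesis using w(2) by (intro exI[of _ "s * p"]) (auto simp flip: P.scale_scale)
  qed
  then show ?thesis using that[of "f ` B"] B(1) by blast
qed

text \<open>Each vector has a nonzero multiple in the span of a finite set \<open>F\<close>, and
  \<open>card F + 1\<close> coefficient rows are dependent. Cutting at the last nonzero coefficient
  gives the top term on which later arguments rest.\<close>

lemma sequence_relation:
  fixes f :: "nat \<Rightarrow> 'a"
  shows "\<exists>N p. p N \<noteq> 0 \<and> (\<Sum>i\<le>N. p i \<odot> f i) = 0"
proof -
  obtain F where F: "finite F" "\<And>v. \<exists>s. s \<noteq> 0 \<and> s \<odot> v \<in> P.span F"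
    using finite_full_rank_set by blast
  have "\<forall>v. \<exists>s a. s \<noteq> 0 \<and> s \<odot> v = (\<Sum>b\<in>F. a b \<odot> b)"
    using F(2) unfolding P.span_finite[OF F(1)] by blast
  then obtain s a where sa: "\<And>v. s v \<noteq> 0 \<and> s v \<odot> v = (\<Sum>b\<in>F. a v b \<odot> b)" by metis
  obtain c where c: "\<exists>i\<in>{..card F}. c i \<noteq> 0" "\<forall>b\<in>F. (\<Sum>i\<le>card F. c i * a (f i) b) = 0"
    using overdetermined_relation[of F "{..card F}" "\<lambda>i. a (f i)"] F(1) by auto
  define N where "N = Max {i. i \<le> card F \<and> c i \<noteq> 0}"
  have "N \<in> {i. i \<le> card F \<and> c i \<noteq> 0}"
    unfolding N_def using c(1) by (intro Max_in) auto
  then have N: "N \<le> card F" "c N \<noteq> 0" by auto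
  have "c i = 0" if "i \<le> card F" "\<not> i \<le> N" for i
    using that Max_ge[of "{i. i \<le> card F \<and> c i \<noteq> 0}" i] by (auto simp: N_def)
  then have "(\<Sum>i\<le>N. (c i * s (f i)) \<odot> f i) = (\<Sum>i\<le>card F. (c i * s (f i)) \<odot> f i)"
    using N(1) by (intro sum.mono_neutral_left) (auto simp: act_0)
  also have "\<dots> = (\<Sum>i\<le>card F. c i \<odot> (\<Sum>b\<in>F. a (f i) b \<odot> b))"
    by (rule sum.cong) (simp_all add: sa flip: P.scale_scale)
  also have "\<dots> = (\<Sum>b\<in>F. (\<Sum>i\<le>card F. c i * a (f i) b) \<odot> b)"
    by (simp add: P.scale_sum_right P.scale_sum_left sum.swap[of _ F])
  also have "\<dots> = 0" using c(2) by (simp add: act_0)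
  finally show ?thesis using N sa by (intro exI[of _ N] exI[of _ "\<lambda>i. c i * s (f i)"]) auto
qed

text \<open>If \<open>A w = 0\<close>, the elements \<open>B\<^sup>k w\<close> are linearly independent since \<open>A\<^sup>m\<close> maps \<open>B\<^sup>m w\<close> to a
  nonzero multiple of \<open>w\<close> and kills \<open>B\<^sup>k w\<close> for \<open>k < m\<close>.\<close>

lemma ladder_injective:
  assumes A: "semilinear A c" and B: "semilinear B (- c)"
    and comm: "\<And>v. A (B v) = B (A v) + [:0, e:] \<odot> v" and "e \<noteq> 0" and "A w = 0"
  shows "w = 0"
proof (rule ccontr)
  assume w: "w \<noteq> 0"
  interpret A: additive A using A by (rule semilinear_additive)
  interpret B: additive B using B by (rule semilinear_additive)
  \<comment> \<open>Each passage of \<open>A\<close> through \<open>B\<close> adds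
    \<open>[:0, e:]\<close>, so the slope grows to \<open>(k + 1) e\<close>. Only this nonzero slope
    matters; the constant term \<open>t\<close> is left open.\<close>
  have lower: "\<exists>t. A ((B ^^ Suc k) w) = [:t, of_nat (Suc k) * e:] \<odot> (B ^^ k) w" for k
  proof (induction k)
    case 0
    then show ?case using comm[of w] \<open>A w = 0\<close> by (auto simp: B.zero)
  next
    case (Suc k)
    then obtain t where "A ((B ^^ Suc k) w) = [:t, of_nat (Suc k) * e:] \<odot> (B ^^ k) w" by blast
    then have "A ((B ^^ Suc (Suc k)) w)
        = (shift (- c) [:t, of_nat (Suc k) * e:] + [:0, e:]) \<odot> (B ^^ Suc k) w"
      using comm[of "(B ^^ Suc k) w"] by (simp add: semilinear_act[OF B] act_add_left)
    also have "shift (- c) [:t, of_nat (Suc k) * e:] + [:0, e:]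
        = [:t - c * of_nat (Suc k) * e, of_nat (Suc (Suc k)) * e:]"
      by (simp add: pcompose_pCons algebra_simps)
    finally show ?case by blast
  qed
  have power_zero: "(A ^^ k) 0 = 0" for k by (induction k) (simp_all add: A.zero)
  have power_add: "(A ^^ k) (v + v') = (A ^^ k) v + (A ^^ k) v'" for k v v'
    by (induction k) (simp_all add: A.add)
  have power_act: "(A ^^ k) (p \<odot> v) = shift (of_nat k * c) p \<odot> (A ^^ k) v" for k p v
    by (induction k) (simp_all add: semilinear_act[OF A] shift_shift algebra_simps)
  have bottom: "\<exists>p. p \<noteq> 0 \<and> (A ^^ k) ((B ^^ k) w) = p \<odot> w" for k
  proof (induction k)
    case 0
    show ?case by (rule exI[of _ 1]) simp
  next
    case (Suc k)
    then obtain p where p: "p \<noteq> 0" "(A ^^ k) ((B ^^ k) w) = p \<odot> w" by blast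
    obtain t where t: "A ((B ^^ Suc k) w) = [:t, of_nat (Suc k) * e:] \<odot> (B ^^ k) w"
      using lower by blast
    have "(A ^^ Suc k) ((B ^^ Suc k) w) = (A ^^ k) (A ((B ^^ Suc k) w))"
      by (simp only: funpow_Suc_right o_apply)
    also have "\<dots> = (shift (of_nat k * c) [:t, of_nat (Suc k) * e:] * p) \<odot> w"
      unfolding t power_act p by simp
    finally have "(A ^^ Suc k) ((B ^^ Suc k) w) = (shift (of_nat k * c) [:t, of_nat (Suc k) * e:] * p) \<odot> w" .
    moreover have "[:t, of_nat (Suc k) * e:] \<noteq> 0" using \<open>e \<noteq> 0\<close> by (simp del: of_nat_Suc)
    then have "shift (of_nat k * c) [:t, of_nat (Suc k) * e:] * p \<noteq> 0"
      using p(1) by (metis shift_eq_0_iff no_zero_divisors)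
    ultimately show ?case by blast
  qed
  have killed: "(A ^^ m) ((B ^^ k) w) = 0" if "k < m" for k m
  proof -
    obtain p where p: "(A ^^ k) ((B ^^ k) w) = p \<odot> w" using bottom by blast
    define d where "d = m - Suc k"
    then have m: "m = d + Suc k" using that by simp
    have "(A ^^ m) ((B ^^ k) w) = (A ^^ d) (A ((A ^^ k) ((B ^^ k) w)))"
      by (simp only: m funpow_add funpow.simps(2) o_apply)
    then show ?thesis using p \<open>A w = 0\<close> by (simp add: semilinear_act[OF A] power_zero)
  qed
  obtain N p where Np: "p N \<noteq> 0" "(\<Sum>i\<le>N. p i \<odot> (B ^^ i) w) = 0"
    using sequence_relation[of "\<lambda>i. (B ^^ i) w"] by blast
  interpret AN: additive "A ^^ N" by standard (rule power_add)
  \<comment> \<open>Applying \<open>A ^^ N\<close> kills the terms with \<open>i < N\<close> and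
    leaves a nonzero multiple of \<open>w\<close>, contradicting the relation.\<close>
  have "(A ^^ N) (\<Sum>i\<le>N. p i \<odot> (B ^^ i) w) = (\<Sum>i\<le>N. shift (of_nat N * c) (p i) \<odot> (A ^^ N) ((B ^^ i) w))"
    by (simp add: AN.sum power_act)
  also have "\<dots> = (\<Sum>i\<in>{N}. shift (of_nat N * c) (p i) \<odot> (A ^^ N) ((B ^^ i) w))"
    by (rule sum.mono_neutral_right) (auto simp: killed)
  finally have "shift (of_nat N * c) (p N) \<odot> (A ^^ N) ((B ^^ N) w) = 0"
    using Np(2) by (simp add: AN.zero)
  then show False using bottom[of N] w Np(1) by (auto simp: act_eq_0_iff shift_eq_0_iff)
qed

text \<open>Take a relation among the \<open>(A ^^ i) v\<close>. If its coefficient at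
  \<open>i = 0\<close> is nonzero, it sends \<open>v\<close> into the image; otherwise
  \<open>A\<close> factors out, injectivity cancels it, and the relation gets shorter.\<close>

lemma torsion_modulo_image:
  assumes A: "semilinear A c" and inj: "\<And>v. A v = 0 \<Longrightarrow> v = 0"
  shows "\<exists>h. h \<noteq> 0 \<and> h \<odot> v \<in> range A"
proof -
  interpret A: additive A using A by (rule semilinear_additive)
  have range: "P.subspace (range A)" using semilinear_image_subspace[OF A] by simp
  have "\<exists>h. h \<noteq> 0 \<and> h \<odot> v \<in> range A"
    if "p N \<noteq> 0" "(\<Sum>i\<le>N. p i \<odot> (A ^^ i) v) = 0" for p N
    using that
  proof (induction N arbitrary: p)
    case 0
    then show ?case using P.subspace_0[OF range] by auto
  next
    case (Suc N)
    have split: "p 0 \<odot> v + (\<Sum>i\<le>N. p (Suc i) \<odot> A ((A ^^ i) v)) = 0"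
      using Suc.prems(2) by (simp add: sum.atMost_Suc_shift del: sum.atMost_Suc)
    show ?case
    proof (cases "p 0 = 0")
      case True
      have "A (\<Sum>i\<le>N. shift (- c) (p (Suc i)) \<odot> (A ^^ i) v) = 0"
        using split True by (simp add: A.sum semilinear_act[OF A] shift_shift act_0)
      then show ?thesis
        using Suc.IH[of "\<lambda>i. shift (- c) (p (Suc i))"] inj Suc.prems(1) by (simp add: shift_eq_0_iff)
    next
      case False
      have "p 0 \<odot> v = - (\<Sum>i\<le>N. p (Suc i) \<odot> A ((A ^^ i) v))"
        using split by (simp add: eq_neg_iff_add_eq_0)
      also have "\<dots> \<in> range A"
        by (intro P.subspace_neg[OF range] P.subspace_sum[OF range] P.subspace_scale[OF range]) simp
      finally show ?thesis using False by blast
    qed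
  qed
  then show ?thesis using sequence_relation[of "\<lambda>i. (A ^^ i) v"] by blast
qed

text \<open>One multiplier brings \<open>v\<close> into the image of \<open>A\<close>, a second one,
  \<open>s\<close>, brings the preimage into the span and passes through \<open>A\<close> as
  \<open>shift c s\<close>.\<close>

lemma full_rank_image:
  assumes A: "semilinear A c" and inj: "\<And>v. A v = 0 \<Longrightarrow> v = 0"
    and F: "finite F" "\<And>v. \<exists>s. s \<noteq> 0 \<and> s \<odot> v \<in> P.span F"
  shows "\<exists>h. h \<noteq> 0 \<and> (\<forall>v\<in>P.span F. h \<odot> v \<in> A ` P.span F)"
proof (rule span_common_multiple[OF _ F(1)])
  show "P.subspace (A ` P.span F)"
    by (rule semilinear_image_subspace[OF A P.subspace_span])
next
  fix v
  obtain h u where h: "h \<noteq> 0" "h \<odot> v = A u"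
    using torsion_modulo_image[OF A inj] by blast
  obtain s where s: "s \<noteq> 0" "s \<odot> u \<in> P.span F" using F(2) by blast
  have "(shift c s * h) \<odot> v = A (s \<odot> u)"
    using h(2) by (simp add: semilinear_act[OF A] flip: P.scale_scale)
  then show "\<exists>h. h \<noteq> 0 \<and> h \<odot> v \<in> A ` P.span F"
    using h(1) s by (intro exI[of _ "shift c s * h"]) (auto simp: shift_eq_0_iff)
qed

text \<open>For a full rank lattice \<open>L\<close>, the multipliers \<open>q\<close> with \<open>q L \<subseteq> U\<close> form an ideal. Comparing \<open>L\<close> with
  \<open>A L\<close> and \<open>B L\<close> shows that its generator satisfies the hypotheses of
  \<open>bounded_by_shift_divisibility\<close>, with \<open>h\<close> and \<open>h'\<close> independent of \<open>U\<close>.\<close>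

lemma uniform_multiplier:
  assumes A: "semilinear A 1" "\<And>v. A v = 0 \<Longrightarrow> v = 0"
    and B: "semilinear B (-1)" "\<And>v. B v = 0 \<Longrightarrow> v = 0"
  obtains d F where "d \<noteq> 0" "\<And>v. \<exists>s. s \<noteq> 0 \<and> s \<odot> v \<in> P.span F"
    "\<And>U v. P.subspace U \<Longrightarrow> A ` U \<subseteq> U \<Longrightarrow> B ` U \<subseteq> U \<Longrightarrow> essential_submodule sc L0 U
      \<Longrightarrow> v \<in> P.span F \<Longrightarrow> d \<odot> v \<in> U"
proof -
  obtain F where F: "finite F" "\<And>v. \<exists>s. s \<noteq> 0 \<and> s \<odot> v \<in> P.span F"
    using finite_full_rank_set by blast
  obtain h where h: "h \<noteq> 0" "\<And>v. v \<in> P.span F \<Longrightarrow> h \<odot> v \<in> A ` P.span F"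
    using full_rank_image[OF A F] by blast
  obtain h' where h': "h' \<noteq> 0" "\<And>v. v \<in> P.span F \<Longrightarrow> h' \<odot> v \<in> B ` P.span F"
    using full_rank_image[OF B F] by blast
  obtain d where d: "d \<noteq> 0" "\<And>q. q \<noteq> 0 \<Longrightarrow> q dvd shift 1 q * h \<Longrightarrow> q dvd shift (-1) q * h' \<Longrightarrow> q dvd d"
    using bounded_by_shift_divisibility[OF h(1) h'(1)] by blast
  have "d \<odot> v \<in> U" if U: "P.subspace U" "A ` U \<subseteq> U" "B ` U \<subseteq> U" "essential_submodule sc L0 U"
      and v: "v \<in> P.span F" for U v
  proof -
    define I where "I = {q. \<forall>v\<in>P.span F. q \<odot> v \<in> U}"
    have "\<exists>q. q \<noteq> 0 \<and> q \<in> I"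
      using span_common_multiple[OF U(1) F(1)] U(4) by (auto simp: I_def essential_submodule_def)
    \<comment> \<open>A nonzero element of least degree generates the ideal \<open>I\<close>, by
      division with remainder.\<close>
    then obtain q where q: "q \<noteq> 0" "q \<in> I" and min: "\<And>r. r \<noteq> 0 \<Longrightarrow> r \<in> I \<Longrightarrow> degree q \<le> degree r"
      using ex_has_least_nat[of "\<lambda>q. q \<noteq> 0 \<and> q \<in> I" _ degree] by blast
    have q_dvd: "q dvd r" if "r \<in> I" for r
    proof -
      have "(r mod q) \<odot> v = r \<odot> v - (r div q) \<odot> q \<odot> v" for v
        by (simp add: minus_div_mult_eq_mod flip: P.scale_left_diff_distrib)
      then have "r mod q \<in> I"
        using that q(2) U(1) by (auto simp: I_def P.subspace_diff P.subspace_scale simp del: P.scale_scale)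
      then show ?thesis
        using min[of "r mod q"] degree_mod_less'[OF q(1), of r] by (force simp: dvd_eq_mod_eq_0)
    qed
    \<comment> \<open>As \<open>g\<close> maps the lattice into its image under \<open>C\<close>,
      multiplication by \<open>q\<close> can be done before \<open>C\<close>; this is where
      \<open>q\<close> acquires the shift.\<close>
    have step: "shift c q * g \<in> I"
      if C: "semilinear C c" "C ` U \<subseteq> U" "\<And>v. v \<in> P.span F \<Longrightarrow> g \<odot> v \<in> C ` P.span F" for C c g
      unfolding I_def
    proof (intro CollectI ballI)
      fix v assume "v \<in> P.span F"
      then obtain u where u: "u \<in> P.span F" "g \<odot> v = C u" using C(3) by blast
      have "(shift c q * g) \<odot> v = C (q \<odot> u)"
        using u(2) by (simp add: semilinear_act[OF C(1)] flip: P.scale_scale)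
      then show "(shift c q * g) \<odot> v \<in> U" using q(2) u(1) C(2) by (auto simp: I_def)
    qed
    have "q dvd d"
      using d(2)[OF q(1)] q_dvd step[OF A(1) U(2) h(2)] step[OF B(1) U(3) h'(2)] by blast
    then obtain r where "d = r * q" by (metis dvdE mult.commute)
    then have "d \<odot> v = r \<odot> q \<odot> v" by simp
    then show ?thesis using q(2) v U(1) by (metis (mono_tags) I_def P.subspace_scale mem_Collect_eq)
  qed
  then show ?thesis using that[of d F] d(1) F(2) by blast
qed

end

section \<open>Simplicity and irreducibility of the localization\<close>

context torsion_free_space
begin

text \<open>An invariant subspace \<open>W\<close> is compared with the submodule \<open>U\<close>
  of all \<open>v\<close> with \<open>v/1\<close> in \<open>W\<close>: clearing denominators leads
  from \<open>W\<close> to \<open>U\<close>, and dividing leads back.\<close>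

lemma simple_imp_rat_irreducible:
  assumes Lm: "semilinear Lm (-1)" and Lp: "semilinear Lp 1"
    and simple: "simple_sl2_module sc Lm L0 Lp"
  shows "rat_irreducible sc Lm L0 Lp"
proof -
  obtain v :: 'v where "v \<noteq> 0"
    using simple by (auto simp: simple_sl2_module_def simple_submodule_def)
  then have "frac v 1 \<noteq> loc_zero sc L0" by (simp add: frac_eq_zero_iff)
  moreover have carrier: "frac v p \<in> loc_carrier sc L0" if "p \<noteq> 0" for v p
    using that by (auto simp: loc_carrier_iff)
  ultimately have "loc_carrier sc L0 \<noteq> {loc_zero sc L0}" using one_neq_zero by blast
  moreover have "W = {loc_zero sc L0} \<or> W = loc_carrier sc L0"
    if W: "rat_subspace sc L0 W" and inv: "\<forall>X\<in>W. rat_Lm sc Lm L0 X \<in> W \<and> rat_L0 sc L0 X \<in> W \<and> rat_Lp sc Lp L0 X \<in> W"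
    for W
  proof -
    have W_zero: "loc_zero sc L0 \<in> W" and W_carrier: "W \<subseteq> loc_carrier sc L0"
      and W_add: "\<And>X Y. X \<in> W \<Longrightarrow> Y \<in> W \<Longrightarrow> loc_add sc L0 X Y \<in> W"
      and W_scale: "\<And>r X. X \<in> W \<Longrightarrow> loc_scale sc L0 r X \<in> W"
      using W by (auto simp: rat_subspace_def)
    define U where "U = {v. frac v 1 \<in> W}"
    have "P.subspace U"
    proof (rule P.subspaceI)
      show "0 \<in> U" using W_zero by (simp add: U_def loc_zero_def)
      show "v + w \<in> U" if "v \<in> U" "w \<in> U" for v w
        using that W_add[of "frac v 1" "frac w 1"] by (simp add: U_def frac_add)
      show "p \<odot> v \<in> U" if "v \<in> U" for p v
        using that W_scale[of "frac v 1" "Fract p 1"] by (simp add: U_def frac_scale)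
    qed
    moreover have "Lm v \<in> U" "Lp v \<in> U" if "v \<in> U" for v
      using that inv frac_op[OF Lm, of 1 v] frac_op[OF Lp, of 1 v]
      by (auto simp: U_def pcompose_1)
    ultimately have "sl2_submodule sc Lm L0 Lp U" by (auto simp: sl2_submodule_iff)
    then consider "U = {0}" | "U = UNIV"
      using simple by (auto simp: simple_sl2_module_def simple_submodule_def)
    then show ?thesis
    proof cases
      case 1
      have "X = loc_zero sc L0" if XW: "X \<in> W" for X
      proof -
        obtain v p where X: "p \<noteq> 0" "X = frac v p"
          using subsetD[OF W_carrier XW] by (auto simp: loc_carrier_iff)
        have "loc_scale sc L0 (Fract p 1) X = frac v 1"
          using X by (simp add: frac_scale frac_eq_iff)
        then have "v \<in> U" using W_scale[OF XW] by (metis U_def mem_Collect_eq)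
        then show ?thesis using 1 X by (simp add: frac_eq_zero_iff)
      qed
      then show ?thesis using W_zero by blast
    next
      case 2
      have "frac v p \<in> W" if "p \<noteq> 0" for v p
      proof -
        have "frac v 1 \<in> W" using 2 by (auto simp: U_def)
        from W_scale[OF this, of "Fract 1 p"] show ?thesis using that by (simp add: frac_scale)
      qed
      then show ?thesis using W_carrier by (auto simp: loc_carrier_iff)
    qed
  qed
  ultimately show ?thesis by (auto simp: rat_irreducible_def)
qed

text \<open>The fractions with numerator in \<open>U\<close> form a nonzero invariant subspace,
  hence everything; then \<open>v/1 = w/p\<close> with \<open>w\<close> in \<open>U\<close> gives
  \<open>p \<odot> v = w\<close>.\<close>

lemma rat_irreducible_imp_essential:
  assumes Lm: "semilinear Lm (-1)" and Lp: "semilinear Lp 1"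
    and irred: "rat_irreducible sc Lm L0 Lp"
    and U: "sl2_submodule sc Lm L0 Lp U" "U \<noteq> {0}"
  shows "essential_submodule sc L0 U"
proof -
  define W where "W = {frac v p |v p. v \<in> U \<and> p \<noteq> 0}"
  have WI: "frac v p \<in> W" if "v \<in> U" "p \<noteq> 0" for v p using that unfolding W_def by blast
  have WE: "\<exists>v p. v \<in> U \<and> p \<noteq> 0 \<and> X = frac v p" if "X \<in> W" for X
    using that unfolding W_def by blast
  have sub: "P.subspace U" "Lm ` U \<subseteq> U" "Lp ` U \<subseteq> U" "L0 ` U \<subseteq> U"
    using U(1) by (auto simp: sl2_submodule_iff P_subspace_iff)
  have L0: "semilinear L0 0" by (rule semilinearI[OF linear_L0]) simp
  have "rat_subspace sc L0 W" unfolding W_def by (rule fractions_rat_subspace[OF sub(1)])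
  moreover have "rat_Lm sc Lm L0 X \<in> W \<and> rat_L0 sc L0 X \<in> W \<and> rat_Lp sc Lp L0 X \<in> W" if "X \<in> W" for X
    using WE[OF that] sub(2-4) by (auto simp: frac_op[OF Lm] frac_op[OF Lp] frac_op[OF L0] shift_eq_0_iff image_subset_iff intro!: WI)
  ultimately consider "W = {loc_zero sc L0}" | "W = loc_carrier sc L0"
    using irred by (auto simp: rat_irreducible_def)
  then show ?thesis
  proof cases
    case 1
    obtain u where "u \<in> U" "u \<noteq> 0" using U(2) P.subspace_0[OF sub(1)] by blast
    then have "frac u 1 \<in> W" "frac u 1 \<noteq> loc_zero sc L0" by (simp_all add: WI frac_eq_zero_iff)
    then show ?thesis using 1 by blast
  next
    case 2
    have "\<exists>p. p \<noteq> 0 \<and> p \<odot> v \<in> U" for v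
    proof -
      have "frac v 1 \<in> W" unfolding 2 loc_carrier_iff by (intro exI conjI) auto
      then obtain w p where "w \<in> U" "p \<noteq> 0" "frac v 1 = frac w p" using WE by blast
      then show ?thesis by (auto simp: frac_eq_iff)
    qed
    then show ?thesis by (simp add: essential_submodule_def)
  qed
qed

end

theorem theorem7p20:
  fixes sc :: "complex \<Rightarrow> 'v::ab_group_add \<Rightarrow> 'v"
    and Lm L0 Lp :: "'v \<Rightarrow> 'v"
  assumes "sl2_module sc Lm L0 Lp"
    and "torsion_free sc L0"
    and "finite_rank sc L0"
  shows "(simple_sl2_module sc Lm L0 Lp \<longrightarrow> rat_irreducible sc Lm L0 Lp) \<and>
         (rat_irreducible sc Lm L0 Lp \<longrightarrow>
            simple_sl2_module sc Lm L0 Lp \<or>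
            (\<exists>V'. simple_submodule sc Lm L0 Lp V' \<and> essential_submodule sc L0 V' \<and>
                  (\<forall>W. simple_submodule sc Lm L0 Lp W \<longrightarrow> W = V')))"
proof -
  interpret vector_space sc using assms(1) by (simp add: sl2_module_def)
  interpret finite_rank_space sc L0
    using assms by unfold_locales
      (auto simp: sl2_module_def Vector_Spaces.linear_def module_hom_def module_hom_axioms_def)
  have linear: "Vector_Spaces.linear sc sc Lm" "Vector_Spaces.linear sc sc Lp"
    and comm: "L0 (Lm v) - Lm (L0 v) = Lm v" "L0 (Lp v) - Lp (L0 v) = - Lp v"
      "Lp (Lm v) - Lm (Lp v) = sc 2 (L0 v)" for v
    using assms(1) by (auto simp: sl2_module_def)
  have Lm: "semilinear Lm (-1)" and Lp: "semilinear Lp 1"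
    using linear comm by (auto intro!: semilinearI simp: algebra_simps)
  have act: "[:0, a:] \<odot> v = sc a (L0 v)" for a v
    by (simp add: act_pCons act_0 L0.zero L0_scale)
  \<comment> \<open>The bracket of \<open>Lp\<close> and \<open>Lm\<close> is \<open>2 L0\<close>,
    so \<open>e\<close> is \<open>2\<close> here and \<open>-2\<close> with the roles
    exchanged.\<close>
  have inj_Lp: "v = 0" if "Lp v = 0" for v
    using ladder_injective[OF Lp _ _ _ that, of Lm 2] Lm comm(3) by (simp add: act algebra_simps)
  have inj_Lm: "v = 0" if "Lm v = 0" for v
    using ladder_injective[OF Lm _ _ _ that, of Lp "-2"] Lp comm(3) by (simp add: act algebra_simps)
  obtain d F where d: "d \<noteq> 0" and F: "\<And>v. \<exists>s. s \<noteq> 0 \<and> s \<odot> v \<in> P.span F"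
    and multiplier: "\<And>U v. P.subspace U \<Longrightarrow> Lp ` U \<subseteq> U \<Longrightarrow> Lm ` U \<subseteq> U \<Longrightarrow> essential_submodule sc L0 U
      \<Longrightarrow> v \<in> P.span F \<Longrightarrow> d \<odot> v \<in> U"
    using uniform_multiplier[OF Lp inj_Lp Lm inj_Lm] by blast
  have "\<exists>V'. simple_submodule sc Lm L0 Lp V' \<and> essential_submodule sc L0 V' \<and>
      (\<forall>W. simple_submodule sc Lm L0 Lp W \<longrightarrow> W = V')"
    if irred: "rat_irreducible sc Lm L0 Lp"
  proof -
    note essential = rat_irreducible_imp_essential[OF Lm Lp irred]
    \<comment> \<open>Once nonzero, this intersection is the least nonzero submodule, hence simple
      and the only simple one.\<close>
    define V' where "V' = \<Inter>{U. sl2_submodule sc Lm L0 Lp U \<and> U \<noteq> {0}}"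
    have sub: "sl2_submodule sc Lm L0 Lp V'"
      unfolding V'_def sl2_submodule_iff by (auto intro!: P.subspace_Inter)
    have least: "V' \<subseteq> U" if "sl2_submodule sc Lm L0 Lp U" "U \<noteq> {0}" for U
      using that by (auto simp: V'_def)
    have "\<exists>v::'v. v \<noteq> 0"
    proof (rule ccontr)
      assume "\<not> ?thesis"
      then have "X = loc_zero sc L0" if "X \<in> loc_carrier sc L0" for X
        using that by (metis loc_carrier_iff frac_eq_zero_iff)
      moreover have "loc_zero sc L0 \<in> loc_carrier sc L0"
        unfolding loc_zero_def loc_carrier_iff by (intro exI conjI) auto
      ultimately have "loc_carrier sc L0 = {loc_zero sc L0}" by blast
      then show False using irred by (simp add: rat_irreducible_def)
    qed
    \<comment> \<open>Every nonzero submodule is essential and so contains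
      \<open>d \<odot> s \<odot> v\<close>, which torsion freeness keeps nonzero.\<close>
    then obtain v :: 'v and s where "v \<noteq> 0" "s \<noteq> 0" "s \<odot> v \<in> P.span F" using F by blast
    then have "d \<odot> s \<odot> v \<in> V'" "d \<odot> s \<odot> v \<noteq> 0"
      using multiplier essential d
      by (auto simp: V'_def sl2_submodule_iff act_eq_0_iff simp del: P.scale_scale)
    then have "V' \<noteq> {0}" by blast
    then show ?thesis
      using sub least essential[OF sub] unfolding simple_submodule_def by (intro exI[of _ V']) blast
  qed
  then show ?thesis using simple_imp_rat_irreducible[OF Lm Lp] by blast
qed

end
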